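(* Let $\mathcal A$ be a uniform local randomized algorithm solving an LCL problem $\Pi=(\Sigma_{in},\Sigma_{out},t,\mathcal P)$ on the class of bounded degree graphs with randomized complexity $f(n)=o(\log n)$. Then its uniform complexity is $O(f(1/\varepsilon))$.
   Context: The class of bounded degree graphs is the class of graphs of maximum degree at most a fixed constant $\Delta$. An LCL (locally checkable problem) on this class is a quadruple $\Pi=(\Sigma_{in},\Sigma_{out},t,\mathcal P)$, where $\Sigma_{in},\Sigma_{out}$ are finite sets, $t\in\mathbb N$, and $\mathcal P$ is a set of rooted graphs of radius $t$ with each vertex labelled by one input label from $\Sigma_{in}$ and one output label from $\Sigma_{out}$. A labelling of the vertices of a graph by $\Sigma_{in}\times\Sigma_{out}$ is a $\Pi$-coloring if the $t$-hop neighborhood of every vertex is in $\mathcal P$. A uniform local (randomized) algorithm is a pair $\mathcal A=(\mathcal C,g)$, where $\mathcal C$ is a collection of rooted graphs from the class with vertices labelled by both $\Sigma_{in}$ and random strings (independent uniform reals from $[0,1]$), and $g:\mathcal C\to\Sigma_{out}$ is a measurable function. Run at a vertex $u$, the algorithm scans larger and larger neighborhoods of $u$ until it has seen enough (the labelled neighborhood lies in $\mathcal C$) to output a label from $\Sigma_{out}$. It is not given the number of vertices $n$ of the graph, and its output needs to be correct with probability $1$. The coding radius $R_{\mathcal A}$ is the minimal distance needed to output a solution. The randomized complexity of $\mathcal A$ is measured as for classical randomized local algorithms: it is the distance $f(n)$ that the algorithm needs to look at in order to provide a correct answer (a $\Pi$-coloring) on $n$-vertex graphs of the class with probability $1-1/n^{O(1)}$.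 The uniform complexity of $\mathcal A$ is a function $h(\varepsilon)$ such that when the algorithm looks into distance $h(\varepsilon)$, the probability that it needs to look further is at most $\varepsilon$, i.e. $\mathrm P(R_{\mathcal A}>h(\varepsilon))\le\varepsilon$. Here $\mathrm P(R_{\mathcal A}>r)$ means the supremum, over all rooted graphs of radius $r$ from the class with $\Sigma_{in}$-labelled vertices, of the probability that this neighborhood does not suffice for $\mathcal A$ to produce an output at the root. *)

theory Defs
  imports "HOL-Probability.Probability" "HOL-Library.Landau_Symbols"
begin

text \<open>
  Simple undirected graphs, given by a symmetric irreflexive edge relation. Vertices are natural
  numbers, so that up to isomorphism these are exactly the finite and the countably infinite graphs.
\<close>

record graph =
  verts :: "nat set"
  edges :: "(nat \<times> nat) set"

definition bounded_degree_graph :: "nat \<Rightarrow> graph \<Rightarrow> bool" where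
  "bounded_degree_graph \<Delta> G \<longleftrightarrow>
     edges G \<subseteq> verts G \<times> verts G \<and> sym (edges G) \<and> irrefl (edges G) \<and>
     (\<forall>v \<in> verts G. finite (edges G `` {v}) \<and> card (edges G `` {v}) \<le> \<Delta>)"

definition hop_ball :: "graph \<Rightarrow> nat \<Rightarrow> nat \<Rightarrow> nat set" where
  "hop_ball G v r = {u. \<exists>k\<le>r. (v, u) \<in> edges G ^^ k}"

text \<open>
  Rooted labelled graphs of radius \<open>r\<close>: every vertex has distance at most \<open>r\<close> from the root. The
  number \<open>r\<close> is part of the data. A vertex that has scanned its neighborhood up to distance \<open>r\<close>
  knows \<open>r\<close>, and so can tell whether it has seen its whole component (without \<open>r\<close>, an isolated
  vertex could not be told apart from the 0-hop neighborhood of any other vertex, and a uniform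
  algorithm that is correct on isolated vertices would have to stop at distance 0 everywhere).
  Labels are only relevant on the vertices of the underlying graph.
\<close>

record 'l rooted =
  base :: graph
  centre :: nat
  radius :: nat
  label :: "nat \<Rightarrow> 'l"

definition rooted_graph :: "nat \<Rightarrow> 'l set \<Rightarrow> 'l rooted \<Rightarrow> bool" where
  "rooted_graph \<Delta> L H \<longleftrightarrow>
     bounded_degree_graph \<Delta> (base H) \<and> centre H \<in> verts (base H) \<and>
     verts (base H) \<subseteq> hop_ball (base H) (centre H) (radius H) \<and>
     label H ` verts (base H) \<subseteq> L"

definition rooted_iso :: "'l rooted \<Rightarrow> 'l rooted \<Rightarrow> bool" where
  "rooted_iso H K \<longleftrightarrow>
     (\<exists>\<phi>. bij_betw \<phi> (verts (base H)) (verts (base K)) \<and>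
          edges (base K) = map_prod \<phi> \<phi> ` edges (base H) \<and>
          \<phi> (centre H) = centre K \<and> radius H = radius K \<and>
          (\<forall>u \<in> verts (base H). label K (\<phi> u) = label H u))"

definition nbhd :: "graph \<Rightarrow> (nat \<Rightarrow> 'l) \<Rightarrow> nat \<Rightarrow> nat \<Rightarrow> 'l rooted" where
  "nbhd G l v r =
     \<lparr> base = \<lparr> verts = hop_ball G v r,
                edges = edges G \<inter> hop_ball G v r \<times> hop_ball G v r \<rparr>,
       centre = v, radius = r, label = l \<rparr>"

record ('i, 'o) lcl =
  in_labels :: "'i set"
  out_labels :: "'o set"
  lcl_radius :: nat
  allowed :: "('i \<times> 'o) rooted set"

text \<open>Sets of rooted graphs are meant up to isomorphism, hence closed under \<^const>\<open>rooted_iso\<close>.\<close>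

definition is_lcl :: "nat \<Rightarrow> ('i, 'o) lcl \<Rightarrow> bool" where
  "is_lcl \<Delta> L \<longleftrightarrow>
     finite (in_labels L) \<and> finite (out_labels L) \<and>
     (\<forall>H \<in> allowed L. rooted_graph \<Delta> (in_labels L \<times> out_labels L) H \<and> radius H = lcl_radius L) \<and>
     (\<forall>H K. H \<in> allowed L \<and> rooted_iso H K \<longrightarrow> K \<in> allowed L)"

definition lcl_coloring ::
    "('i, 'o) lcl \<Rightarrow> graph \<Rightarrow> (nat \<Rightarrow> 'i) \<Rightarrow> (nat \<Rightarrow> 'o) \<Rightarrow> bool" where
  "lcl_coloring L G i c \<longleftrightarrow>
     (\<forall>v \<in> verts G. nbhd G (\<lambda>u. (i u, c u)) v (lcl_radius L) \<in> allowed L)"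

definition seeds :: "nat set \<Rightarrow> (nat \<Rightarrow> real) measure" where
  "seeds V = PiM V (\<lambda>_. restrict_space lborel {0..1})"

lemma prob_space_seeds: "prob_space (seeds V)"
  unfolding seeds_def by (intro prob_space_PiM prob_space_restrict_space) auto

record ('i, 'o) algorithm =
  halting :: "('i \<times> real) rooted set"
  decide :: "('i \<times> real) rooted \<Rightarrow> 'o"

text \<open>
  The space of rooted graphs labelled by inputs and seeds is the disjoint union, over the rooted
  graphs \<open>H\<close> labelled by inputs only, of the product spaces \<open>seeds (verts (base H))\<close>; measurability
  of \<open>halting A\<close> and of \<open>decide A\<close> on it is measurability on each of these pieces.
\<close>

definition add_seeds :: "'i rooted \<Rightarrow> (nat \<Rightarrow> real) \<Rightarrow> ('i \<times> real) rooted" where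
  "add_seeds H x =
     \<lparr> base = base H, centre = centre H, radius = radius H, label = (\<lambda>u. (label H u, x u)) \<rparr>"

definition uniform_local_algorithm ::
    "nat \<Rightarrow> 'i set \<Rightarrow> 'o set \<Rightarrow> ('i, 'o) algorithm \<Rightarrow> bool" where
  "uniform_local_algorithm \<Delta> In Out A \<longleftrightarrow>
     (\<forall>H \<in> halting A. rooted_graph \<Delta> (In \<times> {0..1}) H) \<and>
     (\<forall>H K. H \<in> halting A \<and> rooted_iso H K \<longrightarrow> K \<in> halting A \<and> decide A K = decide A H) \<and>
     (\<forall>H. rooted_graph \<Delta> In H \<longrightarrow>
        (let M = seeds (verts (base H)); S = {x \<in> space M. add_seeds H x \<in> halting A}
         in S \<in> sets M \<and>
            (\<lambda>x. decide A (add_seeds H x)) \<in> measurable (restrict_space M S) (count_space Out)))"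

definition seeded_nbhd ::
    "graph \<Rightarrow> (nat \<Rightarrow> 'i) \<Rightarrow> (nat \<Rightarrow> real) \<Rightarrow> nat \<Rightarrow> nat \<Rightarrow> ('i \<times> real) rooted" where
  "seeded_nbhd G i x v r = nbhd G (\<lambda>u. (i u, x u)) v r"

text \<open>The coding radius is \<open>\<infinity>\<close> (the infimum of the empty set) if the algorithm never stops.\<close>

definition coding_radius ::
    "('i, 'o) algorithm \<Rightarrow> graph \<Rightarrow> (nat \<Rightarrow> 'i) \<Rightarrow> (nat \<Rightarrow> real) \<Rightarrow> nat \<Rightarrow> enat" where
  "coding_radius A G i x v = Inf {enat r | r. seeded_nbhd G i x v r \<in> halting A}"

definition run ::
    "('i, 'o) algorithm \<Rightarrow> graph \<Rightarrow> (nat \<Rightarrow> 'i) \<Rightarrow> (nat \<Rightarrow> real) \<Rightarrow> nat \<Rightarrow> 'o" where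
  "run A G i x v = decide A (seeded_nbhd G i x v (the_enat (coding_radius A G i x v)))"

definition solves :: "nat \<Rightarrow> ('i, 'o) lcl \<Rightarrow> ('i, 'o) algorithm \<Rightarrow> bool" where
  "solves \<Delta> L A \<longleftrightarrow>
     (\<forall>G i. bounded_degree_graph \<Delta> G \<and> i ` verts G \<subseteq> in_labels L \<longrightarrow>
        (AE x in seeds (verts G).
           (\<forall>v \<in> verts G. coding_radius A G i x v < \<infinity>) \<and> lcl_coloring L G i (run A G i x)))"

text \<open>
  The success probability \<open>1 - 1 / n ^ O(1)\<close> is read as: at least \<open>1 - 1 / n ^ c\<close> for some
  constant \<open>c > 0\<close>.
\<close>

definition randomized_complexity ::
    "nat \<Rightarrow> ('i, 'o) lcl \<Rightarrow> ('i, 'o) algorithm \<Rightarrow> (nat \<Rightarrow> nat) \<Rightarrow> bool" where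
  "randomized_complexity \<Delta> L A f \<longleftrightarrow>
     (\<exists>c>0. \<forall>n\<ge>1. \<forall>G i.
        bounded_degree_graph \<Delta> G \<and> card (verts G) = n \<and> i ` verts G \<subseteq> in_labels L \<longrightarrow>
        measure (seeds (verts G))
          {x \<in> space (seeds (verts G)).
             (\<forall>v \<in> verts G. coding_radius A G i x v \<le> enat (f n)) \<and>
             lcl_coloring L G i (run A G i x)}
        \<ge> 1 - 1 / real n powr c)"

text \<open>
  \<open>P(R > r)\<close>: whether \<open>R > r\<close> holds at the root only depends on the rooted graph of radius \<open>r\<close>
  around it, so the coding radius may be evaluated in that rooted graph.
\<close>

definition tail_prob :: "nat \<Rightarrow> 'i set \<Rightarrow> ('i, 'o) algorithm \<Rightarrow> nat \<Rightarrow> ennreal" where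
  "tail_prob \<Delta> In A r =
     (SUP H \<in> {H. rooted_graph \<Delta> In H \<and> radius H = r}.
        emeasure (seeds (verts (base H)))
          {x \<in> space (seeds (verts (base H))).
             coding_radius A (base H) (label H) x (centre H) > enat r})"

definition uniform_complexity ::
    "nat \<Rightarrow> 'i set \<Rightarrow> ('i, 'o) algorithm \<Rightarrow> (real \<Rightarrow> nat) \<Rightarrow> bool" where
  "uniform_complexity \<Delta> In A h \<longleftrightarrow> (\<forall>\<epsilon>>0. tail_prob \<Delta> In A (h \<epsilon>) \<le> ennreal \<epsilon>)"

end

theory Submission
  imports Defs
begin

text \<open>
  Let \<open>H\<close> be a rooted graph of radius \<open>f n\<close> with \<open>m\<close> vertices; as \<open>f n = o(ln n)\<close>, \<open>m = n\<^sup>o\<^sup>(\<^sup>1\<^sup>)\<close>. If the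
  algorithm needs to look beyond \<open>H\<close> with probability \<open>p\<close>, then on the \<open>n\<close>-vertex graph made of
  \<open>n div m\<close> disjoint copies of \<open>H\<close> and some isolated vertices it stays within distance \<open>f n\<close> with
  probability at most \<open>(1 - p) ^ (n div m)\<close>. This is at least \<open>1 - 1 / n powr c\<close>, whence
  \<open>p \<le> 4 * m / n powr (1 + c) \<le> 1 / n\<close> for large \<open>n\<close>. Thus radius \<open>f n\<close> with \<open>n \<ge> 1 / \<epsilon>\<close> suffices
  for failure probability \<open>\<epsilon>\<close>, however small the exponent \<open>c\<close> is.
\<close>

section \<open>Balls in graphs of bounded degree\<close>

lemma relpow_in_verts:
  assumes "edges G \<subseteq> verts G \<times> verts G" "v \<in> verts G" "(v, u) \<in> edges G ^^ k"
  shows "u \<in> verts G"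
  using assms(3) assms(1,2) by (induction k arbitrary: u) auto

lemma hop_ball_subset_verts:
  assumes "edges G \<subseteq> verts G \<times> verts G" "v \<in> verts G"
  shows "hop_ball G v r \<subseteq> verts G"
  using relpow_in_verts[OF assms] by (auto simp: hop_ball_def)

lemma centre_in_hop_ball [simp]: "v \<in> hop_ball G v r"
  unfolding hop_ball_def by (auto intro: exI[of _ 0])

lemma hop_ball_0: "hop_ball G v 0 = {v}"
  by (auto simp: hop_ball_def)

lemma hop_ball_Suc: "hop_ball G v (Suc r) = hop_ball G v r \<union> edges G `` hop_ball G v r"
proof (intro equalityI subsetI)
  fix u assume "u \<in> hop_ball G v (Suc r)"
  then obtain k where k: "k \<le> Suc r" "(v, u) \<in> edges G ^^ k"
    by (auto simp: hop_ball_def)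
  show "u \<in> hop_ball G v r \<union> edges G `` hop_ball G v r"
  proof (cases "k \<le> r")
    case True
    with k show ?thesis by (auto simp: hop_ball_def)
  next
    case False
    with k have "(v, u) \<in> edges G ^^ Suc r" by (metis le_SucE)
    then show ?thesis by (auto simp: hop_ball_def)
  qed
next
  fix u assume "u \<in> hop_ball G v r \<union> edges G `` hop_ball G v r"
  then consider k where "k \<le> r" "(v, u) \<in> edges G ^^ k"
    | w k where "k \<le> r" "(v, w) \<in> edges G ^^ k" "(w, u) \<in> edges G"
    by (auto simp: hop_ball_def)
  then show "u \<in> hop_ball G v (Suc r)"
  proof cases
    case 1
    then show ?thesis by (auto simp: hop_ball_def intro: le_SucI)
  next
    case 2
    then have "(v, u) \<in> edges G ^^ Suc k" by auto
    with 2 show ?thesis unfolding hop_ball_def by blast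
  qed
qed

text \<open>By \<open>hop_ball_Suc\<close>, one more hop keeps the ball and adds at most \<Delta>
  neighbors for each of its vertices, which costs a factor \<open>Suc \<Delta>\<close>. This base is
  at least 1 even for \<Delta> = 0.\<close>

lemma card_hop_ball:
  assumes "bounded_degree_graph \<Delta> G" "v \<in> verts G"
  shows "finite (hop_ball G v r)" "card (hop_ball G v r) \<le> Suc \<Delta> ^ r"
proof -
  have "finite (hop_ball G v r) \<and> card (hop_ball G v r) \<le> Suc \<Delta> ^ r"
  proof (induction r)
    case 0
    then show ?case by (simp add: hop_ball_0)
  next
    case (Suc r)
    let ?B = "hop_ball G v r"
    have B: "?B \<subseteq> verts G"
      using assms by (intro hop_ball_subset_verts) (auto simp: bounded_degree_graph_def)
    have deg: "finite (edges G `` {u})" "card (edges G `` {u}) \<le> \<Delta>" if "u \<in> ?B" for u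
      using that B assms(1) by (auto simp: bounded_degree_graph_def)
    have E: "edges G `` ?B = (\<Union>u\<in>?B. edges G `` {u})" by auto
    have "card (edges G `` ?B) \<le> (\<Sum>u\<in>?B. card (edges G `` {u}))"
      unfolding E using Suc by (intro card_UN_le) auto
    also have "\<dots> \<le> (\<Sum>u\<in>?B. \<Delta>)"
      by (intro sum_mono deg)
    finally have "card (edges G `` ?B) \<le> card ?B * \<Delta>" by simp
    then have "card (?B \<union> edges G `` ?B) \<le> card ?B * Suc \<Delta>"
      using card_Un_le[of ?B "edges G `` ?B"] by simp
    also have "\<dots> \<le> Suc \<Delta> ^ r * Suc \<Delta>"
      using Suc by (intro mult_right_mono) auto
    finally show ?case
      using Suc deg by (auto simp: hop_ball_Suc E mult.commute)
  qed
  then show "finite (hop_ball G v r)" "card (hop_ball G v r) \<le> Suc \<Delta> ^ r" by auto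
qed

lemma card_rooted_graph:
  assumes "rooted_graph \<Delta> In H"
  shows "finite (verts (base H))" "card (verts (base H)) \<le> Suc \<Delta> ^ radius H"
proof -
  let ?B = "hop_ball (base H) (centre H) (radius H)"
  have H: "bounded_degree_graph \<Delta> (base H)" "centre H \<in> verts (base H)" "verts (base H) \<subseteq> ?B"
    using assms by (auto simp: rooted_graph_def)
  note B = card_hop_ball[OF H(1,2), of "radius H"]
  show "finite (verts (base H))" by (rule finite_subset[OF H(3) B(1)])
  show "card (verts (base H)) \<le> Suc \<Delta> ^ radius H"
    by (rule order_trans[OF card_mono[OF B(1) H(3)] B(2)])
qed

text \<open>All vertices on a walk of length at most r from v lie in the ball of radius r, so the
  walk survives in the induced subgraph. Hence distances from the root do not grow when passing to
  \<open>nbhd\<close>, which makes \<open>nbhd\<close> a rooted graph of radius r.\<close>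

lemma relpow_in_nbhd:
  assumes "(v, u) \<in> edges G ^^ k" "k \<le> r"
  shows "(v, u) \<in> edges (base (nbhd G l v r)) ^^ k"
  using assms
proof (induction k arbitrary: u)
  case (Suc k)
  from Suc.prems(1) obtain w where w: "(v, w) \<in> edges G ^^ k" "(w, u) \<in> edges G" by auto
  have "w \<in> hop_ball G v r" "u \<in> hop_ball G v r"
    using w(1) Suc.prems Suc_leD unfolding hop_ball_def by blast+
  with w Suc.IH[OF w(1)] Suc.prems(2) show ?case by (auto simp: nbhd_def)
qed auto

lemma rooted_graph_nbhd:
  assumes "bounded_degree_graph \<Delta> G" "v \<in> verts G" "l ` verts G \<subseteq> In"
  shows "rooted_graph \<Delta> In (nbhd G l v r)"
proof -
  let ?N = "nbhd G l v r"
  have sub: "hop_ball G v r \<subseteq> verts G"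
    using assms by (intro hop_ball_subset_verts) (auto simp: bounded_degree_graph_def)
  have "finite (edges (base ?N) `` {u}) \<and> card (edges (base ?N) `` {u}) \<le> \<Delta>"
    if "u \<in> hop_ball G v r" for u
  proof -
    have "edges (base ?N) `` {u} \<subseteq> edges G `` {u}" by (auto simp: nbhd_def)
    moreover have "finite (edges G `` {u})" "card (edges G `` {u}) \<le> \<Delta>"
      using that sub assms(1) by (auto simp: bounded_degree_graph_def)
    ultimately show ?thesis by (meson card_mono finite_subset le_trans)
  qed
  moreover have "sym (edges (base ?N))" "irrefl (edges (base ?N))"
    using assms(1) by (auto simp: nbhd_def bounded_degree_graph_def sym_def irrefl_def)
  ultimately have "bounded_degree_graph \<Delta> (base ?N)"
    by (auto simp: bounded_degree_graph_def nbhd_def)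
  moreover have "verts (base ?N) \<subseteq> hop_ball (base ?N) v r"
    using relpow_in_nbhd[of v _ _ G r l] unfolding hop_ball_def by (auto simp: nbhd_def hop_ball_def)
  ultimately show ?thesis
    using assms(3) sub by (auto simp: rooted_graph_def nbhd_def)
qed

section \<open>Transport of neighborhoods along embeddings\<close>

text \<open>Equality of whole neighborhoods, rather than mere preservation of edges, means that no
  edge of G' leads from the image of G to a new vertex. Balls of every radius are therefore carried
  onto balls.\<close>

definition component_embedding :: "(nat \<Rightarrow> nat) \<Rightarrow> graph \<Rightarrow> graph \<Rightarrow> bool" where
  "component_embedding \<phi> G G' \<longleftrightarrow>
     inj_on \<phi> (verts G) \<and> (\<forall>u \<in> verts G. edges G' `` {\<phi> u} = \<phi> ` (edges G `` {u}))"

lemma hop_ball_embedding: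
  assumes "component_embedding \<phi> G G'" "edges G \<subseteq> verts G \<times> verts G" "v \<in> verts G"
  shows "hop_ball G' (\<phi> v) r = \<phi> ` hop_ball G v r"
proof (induction r)
  case (Suc r)
  let ?B = "hop_ball G v r"
  have "edges G' `` (\<phi> ` ?B) = (\<Union>u\<in>?B. edges G' `` {\<phi> u})" by auto
  also have "\<dots> = (\<Union>u\<in>?B. \<phi> ` (edges G `` {u}))"
    using hop_ball_subset_verts[OF assms(2,3), of r] assms(1)
    by (intro SUP_cong) (auto simp: component_embedding_def)
  also have "\<dots> = \<phi> ` (edges G `` ?B)" by auto
  finally show ?case by (simp add: hop_ball_Suc Suc image_Un)
qed (simp add: hop_ball_0)

text \<open>This is applied in two ways: with \<open>id\<close>, to replace a labelling by one that
  agrees with it on the ball, and with the inclusion of one of several disjoint copies.\<close>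

lemma rooted_iso_nbhd:
  assumes emb: "component_embedding \<phi> G G'" and E: "edges G \<subseteq> verts G \<times> verts G"
    and v: "v \<in> verts G" and l: "\<And>u. u \<in> hop_ball G v r \<Longrightarrow> l' (\<phi> u) = l u"
  shows "rooted_iso (nbhd G l v r) (nbhd G' l' (\<phi> v) r)"
  unfolding rooted_iso_def
proof (intro exI[of _ \<phi>] conjI)
  let ?B = "hop_ball G v r"
  have B: "?B \<subseteq> verts G" by (rule hop_ball_subset_verts[OF E v])
  have B': "hop_ball G' (\<phi> v) r = \<phi> ` ?B" by (rule hop_ball_embedding[OF emb E v])
  have inj: "inj_on \<phi> (verts G)" and nb: "\<And>u. u \<in> verts G \<Longrightarrow> edges G' `` {\<phi> u} = \<phi> ` (edges G `` {u})"
    using emb by (auto simp: component_embedding_def)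
  show "bij_betw \<phi> (verts (base (nbhd G l v r))) (verts (base (nbhd G' l' (\<phi> v) r)))"
    using inj_on_subset[OF inj B] by (auto simp: nbhd_def B' bij_betw_def)
  have "(\<phi> a, \<phi> b) \<in> edges G' \<longleftrightarrow> (a, b) \<in> edges G" if "a \<in> ?B" "b \<in> ?B" for a b
  proof -
    have "(\<phi> a, \<phi> b) \<in> edges G' \<longleftrightarrow> \<phi> b \<in> \<phi> ` (edges G `` {a})"
      using nb[of a] that B by auto
    also have "\<dots> \<longleftrightarrow> (a, b) \<in> edges G"
      using inj_on_image_mem_iff[OF inj, of b "edges G `` {a}"] that B E by auto
    finally show ?thesis .
  qed
  then show "edges (base (nbhd G' l' (\<phi> v) r)) = map_prod \<phi> \<phi> ` edges (base (nbhd G l v r))"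
    by (auto simp: nbhd_def B' image_iff)
qed (use l in \<open>auto simp: nbhd_def\<close>)

text \<open>The inverse bijection undoes \<phi> only on the vertices of H, so the edges and the
  centre of H must live there to be recovered.\<close>

lemma rooted_iso_sym:
  assumes "rooted_iso H K" "edges (base H) \<subseteq> verts (base H) \<times> verts (base H)"
    and "centre H \<in> verts (base H)"
  shows "rooted_iso K H"
proof -
  obtain \<phi> where \<phi>: "bij_betw \<phi> (verts (base H)) (verts (base K))"
    "edges (base K) = map_prod \<phi> \<phi> ` edges (base H)" "\<phi> (centre H) = centre K"
    "radius H = radius K" "\<forall>u \<in> verts (base H). label K (\<phi> u) = label H u"
    using assms(1) by (auto simp: rooted_iso_def)
  define \<psi> where "\<psi> = inv_into (verts (base H)) \<phi>"
  have \<psi>: "\<psi> (\<phi> u) = u" if "u \<in> verts (base H)" for u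
    using that \<phi>(1) by (auto simp: \<psi>_def bij_betw_def)
  show ?thesis
    unfolding rooted_iso_def
  proof (intro exI[of _ \<psi>] conjI)
    show "bij_betw \<psi> (verts (base K)) (verts (base H))"
      unfolding \<psi>_def by (rule bij_betw_inv_into[OF \<phi>(1)])
    have "map_prod \<psi> \<psi> (map_prod \<phi> \<phi> e) = e" if "e \<in> edges (base H)" for e
      using that assms(2) \<psi> by (cases e) auto
    then show "edges (base H) = map_prod \<psi> \<psi> ` edges (base K)"
      unfolding \<phi>(2) image_image by simp
    show "\<psi> (centre K) = centre H"
      using \<psi>[OF assms(3)] \<phi>(3) by simp
    show "\<forall>u\<in>verts (base K). label H (\<psi> u) = label K u"
      using \<phi>(5) \<psi> bij_betw_imp_surj_on[OF \<phi>(1)] by (metis imageE)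
  qed (use \<phi>(4) in simp)
qed

section \<open>The coding radius and the invariance of halting under isomorphism\<close>

lemma coding_radius_le_iff:
  "coding_radius A G i x v \<le> enat r \<longleftrightarrow> (\<exists>s\<le>r. seeded_nbhd G i x v s \<in> halting A)"
proof -
  \<comment> \<open>A strict bound on an infimum yields an element below it, so the bound by r is
    first turned into a strict bound by \<open>Suc r\<close>.\<close>
  have "coding_radius A G i x v \<le> enat r \<longleftrightarrow> coding_radius A G i x v < enat (Suc r)"
    by (cases "coding_radius A G i x v") (auto simp: less_Suc_eq_le)
  also have "\<dots> \<longleftrightarrow> (\<exists>s\<le>r. seeded_nbhd G i x v s \<in> halting A)"
    by (auto simp: coding_radius_def Inf_less_iff less_Suc_eq_le)
  finally show ?thesis .
qed

lemma halting_iso: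
  assumes "uniform_local_algorithm \<Delta> In Out A" "rooted_iso H K" "H \<in> halting A"
  shows "K \<in> halting A"
  using assms(2,3) assms(1)[unfolded uniform_local_algorithm_def, THEN conjunct2, THEN conjunct1, rule_format, of H K]
  by simp

section \<open>Probabilistic tools: independent blocks of coordinates and a Bernoulli-type
  bound\<close>

text \<open>All coordinates together form the identity map, so their joint law is
  \<open>PiM I N\<close>. This is also the product of their marginals, which characterizes
  independence.\<close>

lemma indep_vars_PiM_coordinates:
  fixes I :: "'i set"
  assumes "\<And>i. i \<in> I \<Longrightarrow> prob_space (N i)" "I \<noteq> {}"
  shows "prob_space.indep_vars (PiM I N) N (\<lambda>i x. x i) I"
proof -
  interpret P: prob_space "PiM I N" using assms by (intro prob_space_PiM)
  have "distr (PiM I N) (N i) (\<lambda>x. x i) = N i" if "i \<in> I" for i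
    using assms(1) that by (rule distr_PiM_component)
  then have "PiM I (\<lambda>i. distr (PiM I N) (N i) (\<lambda>x. x i)) = PiM I N"
    by (intro PiM_cong) auto
  moreover have "distr (PiM I N) (PiM I N) (\<lambda>x. \<lambda>i\<in>I. x i) = PiM I N"
    by (rule trans[OF distr_cong[OF refl refl] distr_id]) (auto simp: space_PiM)
  ultimately show ?thesis
    using assms(2) by (subst P.indep_vars_iff_distr_eq_PiM') auto
qed

lemma measure_PiM_blocks:
  fixes \<phi> :: "'j \<Rightarrow> 'v \<Rightarrow> 'i"
  assumes N: "prob_space N" and J: "finite J"
    and inj: "inj_on (case_prod \<phi>) (J \<times> V)"
    and I: "\<And>j u. j \<in> J \<Longrightarrow> u \<in> V \<Longrightarrow> \<phi> j u \<in> I"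
    and B: "B \<in> sets (PiM V (\<lambda>_. N))"
  shows "{x \<in> space (PiM I (\<lambda>_. N)). \<forall>j\<in>J. (\<lambda>u\<in>V. x (\<phi> j u)) \<in> B} \<in> sets (PiM I (\<lambda>_. N))"
    and "measure (PiM I (\<lambda>_. N)) {x \<in> space (PiM I (\<lambda>_. N)). \<forall>j\<in>J. (\<lambda>u\<in>V. x (\<phi> j u)) \<in> B} =
         measure (PiM V (\<lambda>_. N)) B ^ card J"
proof -
  let ?P = "PiM I (\<lambda>_. N)" and ?Q = "PiM V (\<lambda>_. N)"
  let ?X = "\<lambda>j x. \<lambda>u\<in>V. x (\<phi> j u)"
  interpret P: prob_space ?P using N by (intro prob_space_PiM)
  have meas: "?X j \<in> measurable ?P ?Q" if "j \<in> J" for j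
    using I[OF that] by (intro measurable_restrict measurable_component_singleton)
  have eq: "{x \<in> space ?P. \<forall>j\<in>J. ?X j x \<in> B} = (\<Inter>j\<in>J. ?X j -` B \<inter> space ?P)" if "J \<noteq> {}"
    using that by auto
  have single: "?X j -` B \<inter> space ?P \<in> sets ?P" if "j \<in> J" for j
    by (rule measurable_sets[OF meas[OF that] B])
  show "{x \<in> space ?P. \<forall>j\<in>J. ?X j x \<in> B} \<in> sets ?P"
  proof (cases "J = {}")
    case False
    with J single show ?thesis unfolding eq[OF False] by (intro sets.finite_INT) auto
  qed simp
  show "measure ?P {x \<in> space ?P. \<forall>j\<in>J. ?X j x \<in> B} = measure ?Q B ^ card J"
  \<comment> \<open>The degenerate cases are separated because the independence argument requires a
    nonempty I, and the event is an intersection over j only for nonempty J.\<close>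
  proof (cases "J = {} \<or> V = {}")
    case True
    show ?thesis
    proof (cases "J = {}")
      case True
      then show ?thesis using P.prob_space by simp
    next
      case False
      with True have V: "V = {}" by simp
      \<comment> \<open>A product over no coordinates is a one-point space, so B has measure 0 or 1
        and this equals its power with the positive exponent \<open>card J\<close>.\<close>
      have "B = {} \<or> B = {\<lambda>_. undefined}"
        using sets.sets_into_space[OF B] by (auto simp: V space_PiM)
      then show ?thesis
      proof
        assume "B = {}"
        then show ?thesis using False J by (simp add: zero_power card_gt_0_iff)
      next
        assume "B = {\<lambda>_. undefined}"
        moreover have "prob_space ?Q" using N by (intro prob_space_PiM)
        ultimately show ?thesis
          using P.prob_space prob_space.prob_space[of ?Q] by (simp add: V space_PiM restrict_def)
      qed
    qed
  next
    case False
    then have "I \<noteq> {}" using I by auto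
    then have coord: "P.indep_vars (\<lambda>_. N) (\<lambda>i x. x i) I"
      by (rule indep_vars_PiM_coordinates[OF N])
    have disj: "disjoint_family_on (\<lambda>j. \<phi> j ` V) J"
      unfolding disjoint_family_on_def using inj_onD[OF inj, of "(_, _)" "(_, _)"] by auto
    have "P.indep_vars (\<lambda>j. PiM (\<phi> j ` V) (\<lambda>_. N)) (\<lambda>j x. restrict (\<lambda>i. x i) (\<phi> j ` V)) J"
      using I disj by (intro P.indep_vars_restrict[OF coord]) auto
    then have "P.indep_vars (\<lambda>_. ?Q) (\<lambda>j x. ?X j (restrict (\<lambda>i. x i) (\<phi> j ` V))) J"
      by (rule P.indep_vars_compose2)
        (intro measurable_restrict measurable_component_singleton imageI)
    moreover have "(\<lambda>j x. ?X j (restrict (\<lambda>i. x i) (\<phi> j ` V))) = ?X"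
      by (auto simp: fun_eq_iff)
    ultimately have indep: "P.indep_vars (\<lambda>_. ?Q) ?X J"
      by (rule back_subst[of "\<lambda>X. P.indep_vars (\<lambda>_. ?Q) X J"])
    have "P.prob (?X j -` B \<inter> space ?P) = measure ?Q B" if j: "j \<in> J" for j
    proof -
      have "inj_on (\<phi> j) V" using inj j by (auto simp: inj_on_def)
      then have "distr ?P ?Q (?X j) = ?Q"
        using N I[OF j] by (intro distr_PiM_reindex) auto
      then show ?thesis
        using measure_distr[OF meas[OF j] B] by simp
    qed
    then show ?thesis
      using False P.indep_varsD_finite[OF indep, of "\<lambda>_. B"] J B by (simp add: eq)
  qed
qed

text \<open>Bernoulli's inequality for 1 + p, multiplied by (1 - p)^k, leaves (1 - p^2)^k on the
  right. The result bounds (1 - p)^k from above, so that a large power forces p to be small.\<close>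

lemma bernoulli_upper:
  fixes p :: real
  assumes "0 \<le> p" "p \<le> 1" 
  shows "(1 - p) ^ k * (1 + real k * p) \<le> 1"
proof -
  have "(1 - p) ^ k * (1 + real k * p) \<le> (1 - p) ^ k * (1 + p) ^ k"
    using assms Bernoulli_inequality[of p k] by (intro mult_left_mono) auto
  also have "\<dots> = (1 - p\<^sup>2) ^ k"
    by (simp add: power_mult_distrib[symmetric] algebra_simps power2_eq_square)
  also have "\<dots> \<le> 1" using assms by (intro power_le_one) (auto simp: power_le_one)
  finally show ?thesis .
qed

section \<open>Disjoint copies of a graph\<close>

text \<open>\<open>k\<close> disjoint copies of \<open>G\<close>, padded by \<open>s\<close> isolated vertices to adjust the number of vertices.\<close>

definition copies :: "nat \<Rightarrow> nat \<Rightarrow> graph \<Rightarrow> graph" where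
  "copies k s G =
     \<lparr> verts = prod_encode ` ({..<k} \<times> verts G \<union> {k} \<times> {..<s}),
       edges = {(prod_encode (j, a), prod_encode (j, b)) | j a b. j < k \<and> (a, b) \<in> edges G} \<rparr>"

lemma card_copies:
  assumes "finite (verts G)"
  shows "card (verts (copies k s G)) = k * card (verts G) + s"
proof -
  have "card (verts (copies k s G)) = card ({..<k} \<times> verts G \<union> {k} \<times> {..<s})"
    by (simp add: copies_def card_image inj_prod_encode)
  \<comment> \<open>The padding carries the tag k, while the copies carry tags below k, so the two
    sets are disjoint.\<close>
  also have "\<dots> = k * card (verts G) + s"
    using assms by (subst card_Un_disjoint) auto
  finally show ?thesis .
qed

lemma edges_copies:
  "edges (copies k s G) `` {prod_encode (j, u)} =
     (if j < k then (\<lambda>u. prod_encode (j, u)) ` (edges G `` {u}) else {})"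
  by (auto simp: copies_def)

lemma bounded_degree_copies:
  assumes "bounded_degree_graph \<Delta> G"
  shows "bounded_degree_graph \<Delta> (copies k s G)"
proof -
  have "finite (edges (copies k s G) `` {w}) \<and> card (edges (copies k s G) `` {w}) \<le> \<Delta>"
    if w: "w \<in> verts (copies k s G)" for w
  proof -
    obtain j u where ju: "w = prod_encode (j, u)" by (metis prod_decode_inverse surj_pair)
    with w have "j < k \<Longrightarrow> u \<in> verts G" by (auto simp: copies_def)
    then show ?thesis
      using assms unfolding ju edges_copies bounded_degree_graph_def
      by (auto intro: order_trans[OF card_image_le])
  qed
  then show ?thesis
    using assms unfolding bounded_degree_graph_def
    by (auto simp: copies_def sym_def irrefl_def) 
qed

lemma component_embedding_copies:
  "j < k \<Longrightarrow> component_embedding (\<lambda>u. prod_encode (j, u)) G (copies k s G)"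
  by (auto simp: component_embedding_def edges_copies inj_on_def)

section \<open>Halting inside a rooted graph and inside its copies\<close>

text \<open>The complement of the event whose probability enters \<open>tail_prob\<close> at radius
  \<open>radius H\<close>.\<close>

definition halts_within :: "('i, 'o) algorithm \<Rightarrow> 'i rooted \<Rightarrow> (nat \<Rightarrow> real) set" where
  "halts_within A H = {x \<in> space (seeds (verts (base H))).
     coding_radius A (base H) (label H) x (centre H) \<le> enat (radius H)}"

text \<open>The algorithm provides measurability only over the seeds of the vertices of each
  neighborhood. Halting at distance s is pulled back along the restriction of the seeds to the ball
  of radius s, and finitely many s are combined.\<close>

lemma sets_halts_within:
  assumes A: "uniform_local_algorithm \<Delta> In Out A" and H: "rooted_graph \<Delta> In H"
  shows "halts_within A H \<in> sets (seeds (verts (base H)))"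
proof -
  let ?G = "base H" and ?v = "centre H"
  let ?M = "seeds (verts ?G)"
  have G: "bounded_degree_graph \<Delta> ?G" "?v \<in> verts ?G" "label H ` verts ?G \<subseteq> In"
    using H by (auto simp: rooted_graph_def)
  have E: "edges ?G \<subseteq> verts ?G \<times> verts ?G" using G by (simp add: bounded_degree_graph_def)
  have "{x \<in> space ?M. seeded_nbhd ?G (label H) x ?v s \<in> halting A} \<in> sets ?M" for s
  proof -
    let ?B = "hop_ball ?G ?v s"
    let ?N = "nbhd ?G (label H) ?v s"
    let ?S = "{x \<in> space (seeds ?B). add_seeds ?N x \<in> halting A}"
    have sub: "?B \<subseteq> verts ?G" by (rule hop_ball_subset_verts[OF E G(2)])
    have "rooted_graph \<Delta> In ?N" by (rule rooted_graph_nbhd[OF G])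
    then have S: "?S \<in> sets (seeds ?B)"
      using A by (auto simp: uniform_local_algorithm_def Let_def nbhd_def)
    have meas: "(\<lambda>x. restrict x ?B) \<in> measurable ?M (seeds ?B)"
      unfolding seeds_def by (rule measurable_restrict_subset[OF sub])
    \<comment> \<open>Off the ball, \<open>restrict\<close> puts \<open>undefined\<close> in place
      of the seeds. The two labellings agree on the ball, so the identity is an isomorphism and
      halting is the same for both.\<close>
    have "add_seeds ?N (restrict x ?B) \<in> halting A \<longleftrightarrow> seeded_nbhd ?G (label H) x ?v s \<in> halting A" for x
    proof -
      let ?l = "\<lambda>u. (label H u, restrict x ?B u)" and ?l' = "\<lambda>u. (label H u, x u)"
      have "add_seeds ?N (restrict x ?B) = nbhd ?G ?l ?v s"
        by (simp add: add_seeds_def nbhd_def)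
      moreover have id: "component_embedding id ?G ?G"
        by (simp add: component_embedding_def)
      have "rooted_iso (nbhd ?G ?l ?v s) (nbhd ?G ?l' (id ?v) s)"
        by (rule rooted_iso_nbhd[OF id E G(2)]) auto
      moreover from this have "rooted_iso (nbhd ?G ?l' (id ?v) s) (nbhd ?G ?l ?v s)"
        by (rule rooted_iso_sym) (auto simp: nbhd_def)
      ultimately show ?thesis
        unfolding seeded_nbhd_def id_apply by (metis halting_iso[OF A])
    qed
    then have "{x \<in> space ?M. seeded_nbhd ?G (label H) x ?v s \<in> halting A} =
        (\<lambda>x. restrict x ?B) -` ?S \<inter> space ?M"
      using measurable_space[OF meas] by auto
    with measurable_sets[OF meas S] show ?thesis by simp
  qed
  then have "{x \<in> space ?M. \<exists>s\<in>{..radius H}. seeded_nbhd ?G (label H) x ?v s \<in> halting A} \<in> sets ?M"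
    by (intro sets.sets_Collect_finite_Ex) auto
  then show ?thesis
    by (simp only: halts_within_def coding_radius_le_iff Bex_def atMost_iff)
qed

text \<open>A copy is closed under edges, so a run at its centre sees exactly what a run at the
  centre of H sees with the seeds of that copy.\<close>

lemma halts_within_block:
  assumes A: "uniform_local_algorithm \<Delta> In Out A" and H: "rooted_graph \<Delta> In H"
    and j: "j < k" and x: "x \<in> space (seeds (verts (copies k s (base H))))"
    and i: "\<And>u. u \<in> verts (base H) \<Longrightarrow> i (prod_encode (j, u)) = label H u"
    and le: "coding_radius A (copies k s (base H)) i x (prod_encode (j, centre H)) \<le> enat (radius H)"
  shows "(\<lambda>u\<in>verts (base H). x (prod_encode (j, u))) \<in> halts_within A H"
proof -
  let ?G = "base H" and ?v = "centre H" and ?C = "copies k s (base H)"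
  let ?\<phi> = "\<lambda>u. prod_encode (j, u)"
  let ?y = "\<lambda>u\<in>verts ?G. x (?\<phi> u)"
  have G: "edges ?G \<subseteq> verts ?G \<times> verts ?G" "?v \<in> verts ?G"
    using H by (auto simp: rooted_graph_def bounded_degree_graph_def)
  obtain r where r: "r \<le> radius H" "seeded_nbhd ?C i x (?\<phi> ?v) r \<in> halting A"
    using le by (auto simp: coding_radius_le_iff)
  have "rooted_iso (nbhd ?G (\<lambda>u. (label H u, ?y u)) ?v r) (nbhd ?C (\<lambda>u. (i u, x u)) (?\<phi> ?v) r)"
    using hop_ball_subset_verts[OF G, of r] i
    by (intro rooted_iso_nbhd[OF component_embedding_copies[OF j] G]) auto
  then have "rooted_iso (seeded_nbhd ?C i x (?\<phi> ?v) r) (seeded_nbhd ?G (label H) ?y ?v r)"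
    unfolding seeded_nbhd_def by (rule rooted_iso_sym) (auto simp: nbhd_def)
  then have "seeded_nbhd ?G (label H) ?y ?v r \<in> halting A"
    using halting_iso[OF A] r(2) by blast
  moreover have "?y \<in> space (seeds (verts ?G))"
    using x j by (auto simp: seeds_def space_PiM copies_def PiE_def Pi_def)
  ultimately show ?thesis
    using r(1) by (auto simp: halts_within_def coding_radius_le_iff)
qed

lemma halts_within_power:
  assumes A: "uniform_local_algorithm \<Delta> In Out A" and H: "rooted_graph \<Delta> In H"
    and f: "\<forall>G i. bounded_degree_graph \<Delta> G \<and> card (verts G) = n \<and> i ` verts G \<subseteq> In \<longrightarrow>
        q \<le> measure (seeds (verts G))
          {x \<in> space (seeds (verts G)).
             (\<forall>v \<in> verts G. coding_radius A G i x v \<le> enat (radius H)) \<and> Q G i x}"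
  shows "q \<le> measure (seeds (verts (base H))) (halts_within A H) ^ (n div card (verts (base H)))"
proof -
  let ?V = "verts (base H)"
  \<comment> \<open>With m the number of vertices of H, k copies and s isolated vertices give k * m
    + s = n vertices in all.\<close>
  define k s where "k = n div card ?V" and "s = n mod card ?V"
  define C where "C = copies k s (base H)"
  \<comment> \<open>The padding takes the label of the centre, which is a label known to lie in
    \<open>In\<close>.\<close>
  define i where "i = (\<lambda>w. case prod_decode w of (j, u) \<Rightarrow> if j < k then label H u else label H (centre H))"
  have bd: "bounded_degree_graph \<Delta> (base H)" and lab: "label H ` ?V \<subseteq> In" and ctr: "centre H \<in> ?V"
    using H by (auto simp: rooted_graph_def)
  have C: "bounded_degree_graph \<Delta> C" "card (verts C) = n"
    using bounded_degree_copies[OF bd] card_copies[OF card_rooted_graph(1)[OF H]]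
    by (auto simp: C_def k_def s_def)
  have i: "i ` verts C \<subseteq> In"
    using lab ctr by (auto simp: C_def copies_def i_def)
  let ?good = "{x \<in> space (seeds (verts C)).
    (\<forall>v \<in> verts C. coding_radius A C i x v \<le> enat (radius H)) \<and> Q C i x}"
  let ?blocks = "{x \<in> space (seeds (verts C)).
    \<forall>j\<in>{..<k}. (\<lambda>u\<in>?V. x (prod_encode (j, u))) \<in> halts_within A H}"
  interpret P: prob_space "seeds (verts C)" by (rule prob_space_seeds)
  have N: "prob_space (restrict_space lborel {0..1::real})"
    by (intro prob_space_restrict_space) auto
  have inj: "inj_on (\<lambda>(j, u). prod_encode (j, u)) ({..<k} \<times> ?V)"
    by (auto simp: inj_on_def)
  have inC: "prod_encode (j, u) \<in> verts C" if "j \<in> {..<k}" "u \<in> ?V" for j u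
    using that by (auto simp: C_def copies_def)
  note blocks = measure_PiM_blocks[OF N _ inj inC sets_halts_within[OF A H, unfolded seeds_def],
    folded seeds_def]
  have "q \<le> P.prob ?good"
    using f C i by blast
  also have "\<dots> \<le> P.prob ?blocks"
  \<comment> \<open>Monotonicity asks for measurability of the larger event \<open>?blocks\<close>,
    which \<open>measure_PiM_blocks\<close> supplies.\<close>
  proof (rule P.finite_measure_mono)
    show "?good \<subseteq> ?blocks"
    proof safe
      fix x j assume x: "x \<in> space (seeds (verts C))" "j < k"
        "\<forall>v \<in> verts C. coding_radius A C i x v \<le> enat (radius H)"
      show "(\<lambda>u\<in>?V. x (prod_encode (j, u))) \<in> halts_within A H"
        using x inC[of j] ctr
        by (intro halts_within_block[OF A H x(2), of x s i]) (auto simp: i_def C_def)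
    qed
  qed (rule blocks(1); simp)
  also have "\<dots> = measure (seeds ?V) (halts_within A H) ^ k"
    by (subst blocks(2)) auto
  finally show ?thesis by (simp add: k_def)
qed

section \<open>Numerical estimates\<close>

text \<open>Here \<delta> is the failure probability allowed on n vertices and p that at the centre
  of one copy with m vertices. With k = n div m, \<open>bernoulli_upper\<close> yields k * p \<le> 2
  * \<delta>, and n \<le> 2 * k * m turns this into p * n \<le> 4 * m * \<delta>.\<close>

lemma failure_le_inverse:
  fixes p \<delta> :: real
  assumes p: "0 \<le> p" "p \<le> 1" and m: "0 < m" "2 * m \<le> n" and \<delta>: "0 \<le> \<delta>" "4 * real m * \<delta> \<le> 1"
    and pow: "1 - \<delta> \<le> (1 - p) ^ (n div m)"
  shows "p \<le> 1 / real n"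
proof -
  define k where "k = n div m"
  have "4 * \<delta> \<le> 4 * real m * \<delta>" using m \<delta>(1) by (intro mult_right_mono) auto
  with \<delta> have \<delta>': "\<delta> \<le> 1 / 2" by simp
  have "(1 - \<delta>) * (1 + real k * p) \<le> (1 - p) ^ k * (1 + real k * p)"
    using pow p by (intro mult_right_mono) (auto simp: k_def)
  also have "\<dots> \<le> 1" using p by (rule bernoulli_upper)
  finally have "real k * p * (1 - \<delta>) \<le> \<delta>" by (simp add: algebra_simps)
  moreover have "real k * p * (1 / 2) \<le> real k * p * (1 - \<delta>)"
    using \<delta>' p by (intro mult_left_mono) auto
  ultimately have kp: "real k * p \<le> 2 * \<delta>" by simp
  have "n < (k + 1) * m"
    using m(1) by (simp add: k_def dividend_less_div_times)
  \<comment> \<open>The remainder is less than m, which is at most half of n, so the copies cover at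
    least half of the n vertices.\<close>
  with m(2) have "n \<le> 2 * (k * m)" by (simp add: algebra_simps)
  then have "real n \<le> 2 * (real k * real m)" by (metis of_nat_le_iff of_nat_mult of_nat_numeral)
  then have "p * real n \<le> p * (2 * (real k * real m))" using p by (intro mult_left_mono)
  also have "\<dots> = 2 * real m * (real k * p)" by simp
  also have "\<dots> \<le> 2 * real m * (2 * \<delta>)" using kp by (intro mult_left_mono) auto
  also have "\<dots> \<le> 1" using \<delta>(2) by simp
  finally show ?thesis using m by (simp add: field_simps)
qed

lemma eventually_power_le_powr:
  fixes f :: "nat \<Rightarrow> nat" and b c :: real
  assumes f: "(\<lambda>n. real (f n)) \<in> o(\<lambda>n. ln (real n))" and b: "1 \<le> b" and c: "0 < c"
  shows "eventually (\<lambda>n. 4 * b ^ f n \<le> real n powr c) sequentially"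
proof -
  \<comment> \<open>With f n \<le> \<kappa> * ln n, the power of b is at most n^(\<kappa> * ln b),
    hence at most n^(c / 2); the other half of the exponent absorbs the factor 4. The summand 1
    keeps the denominator positive when b = 1.\<close>
  define \<kappa> where "\<kappa> = c / (2 * (ln b + 1))"
  have lnb: "0 \<le> ln b" using b by simp
  have \<kappa>: "0 < \<kappa>" "\<kappa> * ln b \<le> c / 2"
    using c lnb by (auto simp: \<kappa>_def field_simps)
  have "eventually (\<lambda>n. norm (real (f n)) \<le> \<kappa> * norm (ln (real n))) sequentially"
    using f \<kappa>(1) by (rule landau_o.smallD)
  moreover have "filterlim (\<lambda>n. real n powr (c / 2)) at_top sequentially"
    using c by (intro filterlim_compose[OF real_powr_at_top filterlim_real_sequentially]) auto
  then have "eventually (\<lambda>n. 4 \<le> real n powr (c / 2)) sequentially"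
    by (simp add: filterlim_at_top)
  ultimately show ?thesis
    using eventually_ge_at_top[of 1]
  proof eventually_elim
    case (elim n)
    have "real (f n) * ln b \<le> \<kappa> * ln (real n) * ln b"
      using elim lnb by (intro mult_right_mono) auto
    also have "\<dots> \<le> c / 2 * ln (real n)"
      using mult_right_mono[OF \<kappa>(2), of "ln (real n)"] elim by (simp add: mult_ac)
    finally have "exp (real (f n) * ln b) \<le> exp (c / 2 * ln (real n))" by simp
    then have "b ^ f n \<le> real n powr (c / 2)"
      using b elim by (simp add: powr_def exp_of_nat_mult)
    with elim have "4 * b ^ f n \<le> real n powr (c / 2) * real n powr (c / 2)"
      using b by (intro mult_mono) auto
    then show ?case by (simp add: powr_add[symmetric])
  qed
qed

section \<open>From the tail bound to the uniform complexity\<close>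

lemma tail_prob_le:
  assumes A: "uniform_local_algorithm \<Delta> In Out A"
    and p: "\<And>H. rooted_graph \<Delta> In H \<Longrightarrow> radius H = r \<Longrightarrow>
      1 - measure (seeds (verts (base H))) (halts_within A H) \<le> \<epsilon>"
  shows "tail_prob \<Delta> In A r \<le> ennreal \<epsilon>"
  unfolding tail_prob_def
proof (rule SUP_least, clarify)
  fix H :: "'a rooted" assume H: "rooted_graph \<Delta> In H" "r = radius H"
  let ?M = "seeds (verts (base H))"
  interpret P: prob_space ?M by (rule prob_space_seeds)
  have "{x \<in> space ?M. coding_radius A (base H) (label H) x (centre H) > enat (radius H)} =
      space ?M - halts_within A H"
    by (auto simp: halts_within_def)
  then show "emeasure ?M {x \<in> space ?M.
      coding_radius A (base H) (label H) x (centre H) > enat (radius H)} \<le> ennreal \<epsilon>"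
    using P.prob_compl[OF sets_halts_within[OF A H(1)]] p[OF H(1)] H(2)
    by (simp add: P.emeasure_eq_measure ennreal_leI)
qed

theorem lemma2p8:
  fixes \<Delta> :: nat
    and L :: "('i, 'o) lcl"
    and A :: "('i, 'o) algorithm"
    and f :: "nat \<Rightarrow> nat"
  assumes "is_lcl \<Delta> L"
    and "uniform_local_algorithm \<Delta> (in_labels L) (out_labels L) A"
    and "solves \<Delta> L A"
    and "randomized_complexity \<Delta> L A f"
    and "(\<lambda>n. real (f n)) \<in> o(\<lambda>n. ln (real n))"
  shows "\<exists>h. uniform_complexity \<Delta> (in_labels L) A h \<and>
             (\<lambda>\<epsilon>. real (h \<epsilon>)) \<in> O[at_right 0](\<lambda>\<epsilon>. real (f (nat \<lceil>1 / \<epsilon>\<rceil>)))"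
proof -
  note A = assms(2)
  obtain c where c: "c > 0" and succ: "\<And>n G i. n \<ge> 1 \<Longrightarrow>
      bounded_degree_graph \<Delta> G \<and> card (verts G) = n \<and> i ` verts G \<subseteq> in_labels L \<Longrightarrow>
        1 - 1 / real n powr c \<le> measure (seeds (verts G))
          {x \<in> space (seeds (verts G)).
             (\<forall>v \<in> verts G. coding_radius A G i x v \<le> enat (f n)) \<and>
             lcl_coloring L G i (run A G i x)}"
    using assms(4) unfolding randomized_complexity_def by blast
  \<comment> \<open>The exponent \<open>min c 1\<close> serves both size conditions of
    \<open>failure_le_inverse\<close> with \<delta> = n^(-c): the bound by n gives 2 * m \<le> n,
    the bound by n^c gives 4 * m * \<delta> \<le> 1.\<close>
  have "eventually (\<lambda>n. 4 * real (Suc \<Delta>) ^ f n \<le> real n powr min c 1) sequentially"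
    using assms(5) c by (intro eventually_power_le_powr) auto
  then obtain N0 where N0: "\<And>n. n \<ge> N0 \<Longrightarrow> 4 * real (Suc \<Delta>) ^ f n \<le> real n powr min c 1"
    by (auto simp: eventually_sequentially)
  define N where "N = max N0 1"
  have tail: "tail_prob \<Delta> (in_labels L) A (f n) \<le> ennreal (1 / real n)" if n: "n \<ge> N" for n
  proof (rule tail_prob_le[OF A])
    fix H :: "'i rooted" assume H: "rooted_graph \<Delta> (in_labels L) H" "radius H = f n"
    let ?m = "card (verts (base H))"
    interpret P: prob_space "seeds (verts (base H))" by (rule prob_space_seeds)
    have n1: "n \<ge> 1" "n \<ge> N0" using n by (auto simp: N_def)
    have "real ?m \<le> real (Suc \<Delta>) ^ f n"
      using card_rooted_graph(2)[OF H(1)] H(2) by (metis of_nat_le_iff of_nat_power)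
    with N0[OF n1(2)] have m: "4 * real ?m \<le> real n powr min c 1" by simp
    have "real n powr min c 1 \<le> real n powr 1" "real n powr min c 1 \<le> real n powr c"
      using n1 by (intro powr_mono; simp)+
    with m n1 have "4 * real ?m \<le> real n" "4 * real ?m \<le> real n powr c" by auto
    moreover have "0 < ?m"
      using H(1) card_rooted_graph(1)[OF H(1)] by (auto simp: rooted_graph_def card_gt_0_iff)
    moreover have "1 - 1 / real n powr c \<le> P.prob (halts_within A H) ^ (n div ?m)"
      using succ[OF n1(1)] H(2)
      by (intro halts_within_power[OF A H(1), where Q = "\<lambda>G i x. lcl_coloring L G i (run A G i x)"]) auto
    ultimately show "1 - P.prob (halts_within A H) \<le> 1 / real n"
      using n1 P.prob_le_1
      by (intro failure_le_inverse[of _ ?m n "1 / real n powr c"]) (auto simp: field_simps)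
  qed
  \<comment> \<open>The maximum with N makes the tail bound available for every \<epsilon> > 0. Once
    \<epsilon> < 1 / N it has no effect, so near 0 the function h coincides with f at the ceiling of
    1 / \<epsilon>, and the O holds with constant 1.\<close>
  define h where "h = (\<lambda>\<epsilon>::real. f (max N (nat \<lceil>1 / \<epsilon>\<rceil>)))"
  have "uniform_complexity \<Delta> (in_labels L) A h"
    unfolding uniform_complexity_def
  proof (intro allI impI)
    fix \<epsilon> :: real assume \<epsilon>: "\<epsilon> > 0"
    let ?n = "max N (nat \<lceil>1 / \<epsilon>\<rceil>)"
    have "1 / \<epsilon> \<le> real ?n"
      using real_nat_ceiling_ge[of "1 / \<epsilon>"] by linarith
    moreover from \<epsilon> this have "0 < real ?n" by (meson less_le_trans zero_less_divide_1_iff)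
    ultimately have "1 / real ?n \<le> \<epsilon>" using \<epsilon> by (simp add: field_simps)
    with tail[of ?n] show "tail_prob \<Delta> (in_labels L) A (h \<epsilon>) \<le> ennreal \<epsilon>"
      unfolding h_def by (meson ennreal_leI max.cobounded1 order_trans)
  qed
  moreover have "eventually (\<lambda>\<epsilon>. h \<epsilon> = f (nat \<lceil>1 / \<epsilon>\<rceil>)) (at_right (0::real))"
  proof -
    have "eventually (\<lambda>\<epsilon>::real. \<epsilon> \<in> {0<..<1 / real N}) (at_right 0)"
      by (rule eventually_at_right_real) (simp add: N_def)
    then show ?thesis
    proof eventually_elim
      case (elim \<epsilon>)
      then have "real N < 1 / \<epsilon>" by (simp add: N_def field_simps)
      then have "real N \<le> real (nat \<lceil>1 / \<epsilon>\<rceil>)"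
        using real_nat_ceiling_ge[of "1 / \<epsilon>"] by linarith
      then show ?case by (simp add: h_def max_def)
    qed
  qed
  then have "(\<lambda>\<epsilon>. real (h \<epsilon>)) \<in> O[at_right 0](\<lambda>\<epsilon>. real (f (nat \<lceil>1 / \<epsilon>\<rceil>)))"
    by (intro landau_o.big.in_cong[THEN iffD2, OF _ landau_o.big_refl])
      (auto elim: eventually_mono)
  ultimately show ?thesis by blast
qed

end
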